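(* A partition \(\pi\) of a marked poset \((P,\lambda)\) is a face partition if and only if it is \((P,\lambda)\)-compatible, connected and the induced marking \(\lambda/\pi\) on \((P/\pi,\lambda/\pi)\) is strict.
   Context: A marked poset \((P,\lambda)\) is a finite poset \(P\) together with an induced subposet \(P^*\subseteq P\) of marked elements and an order-preserving marking \(\lambda\colon P^*\to\mathbb{R}\); the marking is strict if \(\lambda(a)<\lambda(b)\) whenever \(a<b\). The marked order polyhedron \(\mathcal{O}(P,\lambda)\subseteq\mathbb{R}^P\) is the set of all \(x\in\mathbb{R}^P\) with \(x_p\le x_q\) whenever \(p\le q\) and \(x_a=\lambda(a)\) for all \(a\in P^*\). To each \(x\in\mathcal{O}(P,\lambda)\) one associates the partition \(\pi_x\) of \(P\) induced by the transitive closure of the relation \(p\sim_x q\) if \(x_p=x_q\) and \(p,q\) are comparable. For a non-empty face \(F\) of \(\mathcal{O}(P,\lambda)\), \(\pi_F\) denotes \(\pi_x\) for any \(x\) in the relative interior of \(F\) (this is independent of the choice of \(x\)); a partition \(\pi\) of \(P\) is called a face partition of \((P,\lambda)\) if \(\pi=\pi_F\) for some non-empty face \(F\) of \(\mathcal{O}(P,\lambda)\). A block \(B\) of a partition \(\pi\) is free if \(B\cap P^*=\varnothing\). A partition \(\pi\) of \(P\) is connected if its blocks are connected as induced subposets of \(P\). It is \(P\)-compatible if the relation \(\le\) on \(\pi\) defined as the transitive closure of "\(B\le C\) if \(p\le q\) for some \(p\in B\), \(q\in C\)" is anti-symmetric (so it is a partial order on \(\pi\)). A \(P\)-compatible partition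 \(\pi\) is \((P,\lambda)\)-compatible if whenever \(a\in B\cap P^*\) and \(b\in C\cap P^*\) for blocks \(B\le C\), we have \(\lambda(a)\le\lambda(b)\). For a \((P,\lambda)\)-compatible partition \(\pi\), the quotient marked poset \((P/\pi,\lambda/\pi)\) has underlying poset \(P/\pi\) the poset of blocks of \(\pi\), marked elements \((P/\pi)^*\) the non-free blocks, and marking \((\lambda/\pi)(B)=\lambda(a)\) for any \(a\in B\cap P^*\). *)

theory Defs
  imports "HOL-Analysis.Analysis" "HOL-Library.Disjoint_Sets"
begin

text \<open>
  Posets are given by a carrier \<open>P\<close> and an order relation \<open>R\<close>
  with \<^term>\<open>partial_order_on P R\<close>, so that a poset on \<open>'a\<close> and its
  quotients, which live on \<open>'a set\<close>, are instances of the same notion, and the empty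
  poset is covered. A marking is a total function of which only the values on the
  marked elements \<open>A\<close> are used.
\<close>

definition marked_poset ::
  "'a set \<Rightarrow> ('a \<times> 'a) set \<Rightarrow> 'a set \<Rightarrow> ('a \<Rightarrow> real) \<Rightarrow> bool" where
  "marked_poset P R A lam \<longleftrightarrow>
     finite P \<and> partial_order_on P R \<and> A \<subseteq> P \<and>
     (\<forall>a\<in>A. \<forall>b\<in>A. (a, b) \<in> R \<longrightarrow> lam a \<le> lam b)"

definition strict_marking :: "('a \<times> 'a) set \<Rightarrow> 'a set \<Rightarrow> ('a \<Rightarrow> real) \<Rightarrow> bool" where
  "strict_marking R A lam \<longleftrightarrow>
     (\<forall>a\<in>A. \<forall>b\<in>A. (a, b) \<in> R \<and> a \<noteq> b \<longrightarrow> lam a < lam b)"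

definition comparable :: "('a \<times> 'a) set \<Rightarrow> 'a \<Rightarrow> 'a \<Rightarrow> bool" where
  "comparable R p q \<longleftrightarrow> (p, q) \<in> R \<or> (q, p) \<in> R"

text \<open>
  The space of real functions on \<open>P\<close> is the coordinate subspace of
  \<^typ>\<open>real^'a\<close> of vectors vanishing outside \<open>P\<close>; for \<open>P = UNIV\<close> this is
  all of \<^typ>\<open>real^'a\<close>. Faces and relative interiors do not depend on the ambient
  space.
\<close>

definition marked_order_polyhedron ::
  "'a::finite set \<Rightarrow> ('a \<times> 'a) set \<Rightarrow> 'a set \<Rightarrow> ('a \<Rightarrow> real) \<Rightarrow> (real^'a) set" where
  "marked_order_polyhedron P R A lam =
     {x. (\<forall>p. p \<notin> P \<longrightarrow> x $ p = 0) \<and>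
         (\<forall>p\<in>P. \<forall>q\<in>P. (p, q) \<in> R \<longrightarrow> x $ p \<le> x $ q) \<and>
         (\<forall>a\<in>A. x $ a = lam a)}"

definition point_partition ::
  "'a::finite set \<Rightarrow> ('a \<times> 'a) set \<Rightarrow> real^'a \<Rightarrow> 'a set set" where
  "point_partition P R x =
     P // {(p, q). p \<in> P \<and> q \<in> P \<and> x $ p = x $ q \<and> comparable R p q}\<^sup>+"

text \<open>
  The choice of the relative interior point is immaterial for non-empty faces, see
  \<open>point_partition_eq_partition_of_face\<close> below.
\<close>

definition partition_of_face ::
  "'a::finite set \<Rightarrow> ('a \<times> 'a) set \<Rightarrow> (real^'a) set \<Rightarrow> 'a set set" where
  "partition_of_face P R F = point_partition P R (SOME x. x \<in> rel_interior F)"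

definition face_partition ::
  "'a::finite set \<Rightarrow> ('a \<times> 'a) set \<Rightarrow> 'a set \<Rightarrow> ('a \<Rightarrow> real) \<Rightarrow> 'a set set \<Rightarrow> bool" where
  "face_partition P R A lam \<pi> \<longleftrightarrow>
     (\<exists>F. F face_of marked_order_polyhedron P R A lam \<and> F \<noteq> {} \<and>
          \<pi> = partition_of_face P R F)"

definition connected_subposet :: "('a \<times> 'a) set \<Rightarrow> 'a set \<Rightarrow> bool" where
  "connected_subposet R B \<longleftrightarrow>
     (\<forall>p\<in>B. \<forall>q\<in>B. (p, q) \<in> {(u, v). u \<in> B \<and> v \<in> B \<and> comparable R u v}\<^sup>*)"

definition connected_partition :: "('a \<times> 'a) set \<Rightarrow> 'a set set \<Rightarrow> bool" where
  "connected_partition R \<pi> \<longleftrightarrow> (\<forall>B\<in>\<pi>. connected_subposet R B)"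

definition quotient_order :: "('a \<times> 'a) set \<Rightarrow> 'a set set \<Rightarrow> ('a set \<times> 'a set) set" where
  "quotient_order R \<pi> =
     {(B, C). B \<in> \<pi> \<and> C \<in> \<pi> \<and> (\<exists>p\<in>B. \<exists>q\<in>C. (p, q) \<in> R)}\<^sup>+"

definition poset_compatible :: "('a \<times> 'a) set \<Rightarrow> 'a set set \<Rightarrow> bool" where
  "poset_compatible R \<pi> \<longleftrightarrow> antisym (quotient_order R \<pi>)"

definition marked_poset_compatible ::
  "('a \<times> 'a) set \<Rightarrow> 'a set \<Rightarrow> ('a \<Rightarrow> real) \<Rightarrow> 'a set set \<Rightarrow> bool" where
  "marked_poset_compatible R A lam \<pi> \<longleftrightarrow>
     poset_compatible R \<pi> \<and>
     (\<forall>B\<in>\<pi>. \<forall>C\<in>\<pi>. (B, C) \<in> quotient_order R \<pi> \<longrightarrow>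
        (\<forall>a\<in>B \<inter> A. \<forall>b\<in>C \<inter> A. lam a \<le> lam b))"

definition quotient_marked :: "'a set \<Rightarrow> 'a set set \<Rightarrow> 'a set set" where
  "quotient_marked A \<pi> = {B \<in> \<pi>. B \<inter> A \<noteq> {}}"

text \<open>
  For compatible partitions the value is the same for all marked elements of the block,
  see \<open>quotient_marking_eq\<close> below.
\<close>

definition quotient_marking :: "'a set \<Rightarrow> ('a \<Rightarrow> real) \<Rightarrow> 'a set \<Rightarrow> real" where
  "quotient_marking A lam B = lam (SOME a. a \<in> B \<inter> A)"


lemma quotient_order_refl:
  assumes "partial_order_on P R" "partition_on P \<pi>" "B \<in> \<pi>"
  shows "(B, B) \<in> quotient_order R \<pi>"
proof -
  obtain p where "p \<in> B" "p \<in> P"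
    using assms(2,3) by (auto simp: partition_on_def) (metis UnionI ex_in_conv)
  moreover have "(p, p) \<in> R"
    using assms(1) \<open>p \<in> P\<close>
    by (auto simp: partial_order_on_def preorder_on_def refl_on_def)
  ultimately show ?thesis
    using assms(3) unfolding quotient_order_def by (intro r_into_trancl) auto
qed

lemma quotient_marking_eq:
  assumes "partial_order_on P R" "partition_on P \<pi>" "marked_poset_compatible R A lam \<pi>"
    and "B \<in> \<pi>" "a \<in> B \<inter> A"
  shows "quotient_marking A lam B = lam a"
proof -
  have "(SOME a. a \<in> B \<inter> A) \<in> B \<inter> A"
    using assms(5) by (rule someI)
  with assms(3,4,5) quotient_order_refl[OF assms(1,2,4)] show ?thesis
    unfolding marked_poset_compatible_def quotient_marking_def by (meson order_antisym)
qed

lemma marked_poset_quotient: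
  assumes "marked_poset P R A lam" "partition_on P \<pi>" "marked_poset_compatible R A lam \<pi>"
  shows "marked_poset \<pi> (quotient_order R \<pi>) (quotient_marked A \<pi>) (quotient_marking A lam)"
proof -
  have po: "partial_order_on P R" and fin: "finite P"
    using assms(1) by (auto simp: marked_poset_def)
  have "finite \<pi>"
    using fin assms(2) finite_elements by blast
  moreover have "quotient_order R \<pi> \<subseteq> \<pi> \<times> \<pi>"
    unfolding quotient_order_def by (rule trancl_subset_Sigma) auto
  then have "partial_order_on \<pi> (quotient_order R \<pi>)"
    using quotient_order_refl[OF po assms(2)] assms(3)
    by (auto simp: partial_order_on_def preorder_on_def refl_on_def
        marked_poset_compatible_def poset_compatible_def)
      (simp add: quotient_order_def)
  moreover have "quotient_marking A lam B \<le> quotient_marking A lam C"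
    if BC: "B \<in> quotient_marked A \<pi>" "C \<in> quotient_marked A \<pi>" "(B, C) \<in> quotient_order R \<pi>" for B C
  proof -
    obtain a b where "a \<in> B \<inter> A" "b \<in> C \<inter> A" "B \<in> \<pi>" "C \<in> \<pi>"
      using BC by (auto simp: quotient_marked_def)
    then show ?thesis
      using quotient_marking_eq[OF po assms(2,3)] BC(3) assms(3)
      by (metis marked_poset_compatible_def)
  qed
  ultimately show ?thesis
    by (auto simp: marked_poset_def quotient_marked_def)
qed

lemma rel_interior_polyhedron_eq_coordinates:
  assumes F: "F \<subseteq> marked_order_polyhedron P R A lam" "convex F"
    and x: "x \<in> rel_interior F" and y: "y \<in> F"
    and pq: "p \<in> P" "q \<in> P" "comparable R p q" "x $ p = x $ q"
  shows "y $ p = y $ q"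
proof -
  obtain e where e: "e > 1" "(1 - e) *\<^sub>R y + e *\<^sub>R x \<in> F"
    using convex_rel_interior_if2[OF F(2) x] y hull_inc[of y F] by blast
  have *: "z $ p \<le> z $ q" if "z \<in> F" "p \<in> P" "q \<in> P" "(p, q) \<in> R" for z p q
    using F(1) that by (auto simp: marked_order_polyhedron_def)
  have eq: "((1 - e) *\<^sub>R y + e *\<^sub>R x) $ q - ((1 - e) *\<^sub>R y + e *\<^sub>R x) $ p
      = (1 - e) * (y $ q - y $ p)"
    using pq(4) by (simp add: algebra_simps)
  consider "(p, q) \<in> R" | "(q, p) \<in> R"
    using pq(3) by (auto simp: comparable_def)
  then show ?thesis
  proof cases
    case 1
    have "0 \<le> (1 - e) * (y $ q - y $ p)"
      using *[OF e(2) pq(1,2) 1] eq by linarith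
    with e(1) *[OF y pq(1,2) 1] show ?thesis
      by (simp add: zero_le_mult_iff)
  next
    case 2
    have "(1 - e) * (y $ q - y $ p) \<le> 0"
      using *[OF e(2) pq(2,1) 2] eq by linarith
    with e(1) *[OF y pq(2,1) 2] show ?thesis
      by (simp add: mult_le_0_iff)
  qed
qed

lemma point_partition_eq_partition_of_face:
  assumes "F face_of marked_order_polyhedron P R A lam" "x \<in> rel_interior F"
  shows "point_partition P R x = partition_of_face P R F"
proof -
  have F: "F \<subseteq> marked_order_polyhedron P R A lam" "convex F"
    using assms(1) by (auto simp: face_of_def)
  define y where "y = (SOME x. x \<in> rel_interior F)"
  have y: "y \<in> rel_interior F"
    unfolding y_def using assms(2) by (rule someI)
  have "x \<in> F" "y \<in> F"
    using assms(2) y rel_interior_subset by blast+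
  then have "{(p, q). p \<in> P \<and> q \<in> P \<and> x $ p = x $ q \<and> comparable R p q} =
    {(p, q). p \<in> P \<and> q \<in> P \<and> y $ p = y $ q \<and> comparable R p q}"
    using rel_interior_polyhedron_eq_coordinates[OF F assms(2)]
      rel_interior_polyhedron_eq_coordinates[OF F y] by blast
  then show ?thesis
    by (simp add: partition_of_face_def point_partition_def y_def)
qed

end

theory Submission
  imports Defs
begin

text \<open>
  The partitions of points of the polyhedron are exactly the partitions of its faces, since
  every point lies in the relative interior of the face cut out by the order relations that
  are tight at it. A point induces a strictly monotone function on the quotient poset of its
  partition, and conversely a strict marking of a finite poset extends, one element at a
  time, to a strictly monotone function on the whole poset.
\<close>

section \<open>Extending strict markings to further elements\<close>

text \<open>An unmarked \<open>q\<close> needs a value above all values in \<open>L\<close>, those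
  of marked elements below it, and below all values in \<open>U\<close>, those of marked elements
  above it. Transitivity through \<open>q\<close> puts every element of \<open>L\<close> strictly
  below every element of \<open>U\<close>, and both sets are finite, so a real number fits in
  between.\<close>

lemma strict_marking_extend_one:
  assumes "finite A" "trans r" "strict_marking r A f" "antisym r"
  obtains v where "strict_marking r (insert q A) (f(q := v))"
proof (cases "q \<in> A")
  case True
  then show ?thesis using that[of "f q"] assms(3) by (simp add: insert_absorb)
next
  case False
  define L U where "L = f ` {a\<in>A. (a, q) \<in> r}" and "U = f ` {b\<in>A. (q, b) \<in> r}"
  have fin: "finite L" "finite U" using assms(1) by (auto simp: L_def U_def)
  have LU: "l < u" if lu: "l \<in> L" "u \<in> U" for l u
  proof -
    obtain a b where ab: "a \<in> A" "b \<in> A" "(a, q) \<in> r" "(q, b) \<in> r" "l = f a" "u = f b"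
      using lu unfolding L_def U_def by blast
    have "(a, b) \<in> r" using ab assms(2) by (meson transD)
    \<comment> \<open>If \<open>a = b\<close>, then \<open>q\<close> would be squeezed between
      \<open>a\<close> and itself and hence be marked.\<close>
    moreover have "a \<noteq> b" using ab False antisymD[OF assms(4)] by metis
    ultimately show ?thesis using ab assms(3) by (auto simp: strict_marking_def)
  qed
  obtain v where v: "\<forall>l\<in>L. l < v" "\<forall>u\<in>U. v < u"
  proof -
    \<comment> \<open>\<open>Min\<close> and \<open>Max\<close> are meaningful only for non-empty
      sets, so an empty side is treated separately: there it suffices to step by 1 beyond the other
      extreme.\<close>
    have "\<exists>v. (\<forall>l\<in>L. l < v) \<and> (\<forall>u\<in>U. v < u)"
    proof (cases "L = {}")
      case True
      show ?thesis
      proof (cases "U = {}")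
        case False
        have "\<forall>u\<in>U. Min U - 1 < u" using fin(2)
          by (meson Min_le less_le_trans diff_less_eq less_add_one)
        then show ?thesis using True by auto
      qed (use True in auto)
    next
      case L: False
      show ?thesis
      proof (cases "U = {}")
        case True
        have "\<forall>l\<in>L. l < Max L + 1" using fin(1)
          by (meson Max_ge le_less_trans less_add_one)
        then show ?thesis using True by auto
      next
        case False
        have "Max L < Min U" using LU L False fin by simp
        then obtain v where "Max L < v" "v < Min U" using dense by blast
        then show ?thesis using L False fin by auto
      qed
    qed
    then show ?thesis using that by blast
  qed
  have "strict_marking r (insert q A) (f(q := v))"
    using v assms(3) False by (auto simp: strict_marking_def L_def U_def)
  then show ?thesis by (rule that)
qed

text \<open>Induction over the elements to be added. An element of \<open>A\<close> does not enlarge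
  the domain, and an update outside \<open>A\<close> preserves the prescribed values.\<close>

lemma strict_marking_extend:
  assumes "finite D" "finite A" "trans r" "antisym r" "strict_marking r A f"
  obtains g where "\<forall>a\<in>A. g a = f a" "strict_marking r (A \<union> D) g"
proof -
  have "\<exists>g. (\<forall>a\<in>A. g a = f a) \<and> strict_marking r (A \<union> D) g"
    using assms(1)
  proof induction
    case empty
    then show ?case using assms(5) by auto
  next
    case (insert q D)
    then obtain g where g: "\<forall>a\<in>A. g a = f a" "strict_marking r (A \<union> D) g" by blast
    show ?case
    proof (cases "q \<in> A")
      case True
      then show ?thesis using g by (auto simp: insert_absorb)
    next
      case False
      obtain v where "strict_marking r (insert q (A \<union> D)) (g(q := v))"
        using strict_marking_extend_one[OF _ assms(3) g(2) assms(4)] assms(2) insert.hyps(1)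
        by blast
      moreover have "\<forall>a\<in>A. (g(q := v)) a = f a" using g(1) False by auto
      ultimately show ?thesis by (metis Un_insert_right)
    qed
  qed
  then show ?thesis using that by blast
qed

section \<open>Faces cut out by tight order relations\<close>

text \<open>For \<open>x\<close> in the polyhedron this is the smallest face containing
  \<open>x\<close>. Only order relations are recorded, since the marking equations hold on the whole
  polyhedron.\<close>

definition tight_face ::
  "'a::finite set \<Rightarrow> ('a \<times> 'a) set \<Rightarrow> 'a set \<Rightarrow> ('a \<Rightarrow> real) \<Rightarrow> real^'a \<Rightarrow> (real^'a) set" where
  "tight_face P R A lam x =
     {y \<in> marked_order_polyhedron P R A lam.
        \<forall>p\<in>P. \<forall>q\<in>P. (p, q) \<in> R \<and> x $ p = x $ q \<longrightarrow> y $ p = y $ q}"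

lemma convex_marked_order_polyhedron: "convex (marked_order_polyhedron P R A lam)"
proof (rule convexI)
  fix x y :: "real^'a" and u v :: real
  assume *: "x \<in> marked_order_polyhedron P R A lam" "y \<in> marked_order_polyhedron P R A lam"
    "0 \<le> u" "0 \<le> v" "u + v = 1"
  have "u * lam a + v * lam a = lam a" for a
    using *(5) by (metis distrib_right mult_1)
  then show "u *\<^sub>R x + v *\<^sub>R y \<in> marked_order_polyhedron P R A lam"
    using * by (auto simp: marked_order_polyhedron_def intro!: add_mono mult_left_mono)
qed

text \<open>Each extra condition turns a valid inequality into an equality. At a point of an open
  segment the slack is a combination, with positive coefficients, of the non-negative slacks at the
  endpoints, so it vanishes only if both of these do.\<close>

lemma tight_face_face_of:
  "tight_face P R A lam x face_of marked_order_polyhedron P R A lam"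
proof -
  let ?O = "marked_order_polyhedron P R A lam"
  have conv: "convex (tight_face P R A lam x)"
    using convex_marked_order_polyhedron[of P R A lam]
    by (auto simp: tight_face_def convex_def)
  have "a \<in> tight_face P R A lam x"
    if ab: "a \<in> ?O" "b \<in> ?O" and z: "z \<in> tight_face P R A lam x" "z \<in> open_segment a b" for a b z
  proof -
    obtain t where t: "0 < t" "t < 1" "z = (1 - t) *\<^sub>R a + t *\<^sub>R b"
      using z(2) by (auto simp: in_segment)
    have "a $ p = a $ q" if pq: "p \<in> P" "q \<in> P" "(p, q) \<in> R" "x $ p = x $ q" for p q
    proof -
      have le: "a $ p \<le> a $ q" "b $ p \<le> b $ q"
        using ab pq by (auto simp: marked_order_polyhedron_def)
      have "z $ p = z $ q" using z(1) pq by (auto simp: tight_face_def)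
      then have "(1 - t) * (a $ q - a $ p) + t * (b $ q - b $ p) = 0"
        unfolding t(3) by (simp add: algebra_simps)
      moreover have "0 \<le> (1 - t) * (a $ q - a $ p)" "0 \<le> t * (b $ q - b $ p)"
        using t le by auto
      ultimately have "(1 - t) * (a $ q - a $ p) = 0" by linarith
      with t show ?thesis by simp
    qed
    then show ?thesis using ab(1) by (auto simp: tight_face_def)
  qed
  with conv show ?thesis
    \<comment> \<open>The other endpoint is covered by symmetry of the open segment.\<close>
    unfolding face_of_def by (smt (verit) open_segment_commute mem_Collect_eq subsetI tight_face_def)
qed

text \<open>The criterion used: from each \<open>y\<close> in the convex face, the segment to
  \<open>x\<close> can be prolonged beyond \<open>x\<close> inside the face. Relations tight at
  \<open>x\<close> are tight at \<open>y\<close> too and stay equalities along the line; the others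
  are strict at \<open>x\<close> and survive a small step by continuity.\<close>

lemma rel_interior_tight_face:
  assumes x: "x \<in> marked_order_polyhedron P R A lam"
  shows "x \<in> rel_interior (tight_face P R A lam x)"
proof -
  let ?F = "tight_face P R A lam x"
  have xF: "x \<in> ?F" using x by (auto simp: tight_face_def)
  have conv: "convex ?F"
    using tight_face_face_of by (rule face_of_imp_convex)
  have "\<exists>e>1. (1 - e) *\<^sub>R y + e *\<^sub>R x \<in> ?F" if y: "y \<in> ?F" for y
  proof -
    define w where "w e = (1 - e) *\<^sub>R y + e *\<^sub>R x" for e
    \<comment> \<open>Here \<open>w 1 = x\<close>, and \<open>at_right 1\<close> expresses a step
      slightly beyond \<open>x\<close>.\<close>
    have ev: "\<forall>\<^sub>F e in at_right 1. w e $ p \<le> w e $ q"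
      if pq: "p \<in> P" "q \<in> P" "(p, q) \<in> R" for p q
    proof (cases "x $ p = x $ q")
      case True
      then have "y $ p = y $ q" using y pq by (auto simp: tight_face_def)
      with True show ?thesis by (simp add: w_def)
    next
      case False
      then have "x $ p < x $ q" using x pq by (force simp: marked_order_polyhedron_def)
      moreover have "((\<lambda>e. w e $ q - w e $ p) \<longlongrightarrow> w 1 $ q - w 1 $ p) (at_right 1)"
        unfolding w_def by (intro tendsto_intros)
      ultimately have "\<forall>\<^sub>F e in at_right 1. 0 < w e $ q - w e $ p"
        by (intro order_tendstoD(1)) (auto simp: w_def)
      then show ?thesis by eventually_elim simp
    qed
    \<comment> \<open>As \<open>P\<close> is finite, one \<open>e\<close> works for all pairs at
      once.\<close>
    have "\<forall>\<^sub>F e in at_right 1. \<forall>p\<in>P. \<forall>q\<in>P. (p, q) \<in> R \<longrightarrow> w e $ p \<le> w e $ q"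
      using ev by (auto simp: eventually_ball_finite_distrib intro: eventually_mono)
    then have "\<forall>\<^sub>F e in at_right 1. 1 < e \<and> (\<forall>p\<in>P. \<forall>q\<in>P. (p, q) \<in> R \<longrightarrow> w e $ p \<le> w e $ q)"
      using eventually_at_right_less by (rule eventually_elim2) auto
    then obtain e where e: "1 < e" "\<forall>p\<in>P. \<forall>q\<in>P. (p, q) \<in> R \<longrightarrow> w e $ p \<le> w e $ q"
      using eventually_happens trivial_limit_at_right_real by (metis (no_types, lifting))
    \<comment> \<open>Outside \<open>P\<close> and on \<open>A\<close> the points \<open>x\<close>
      and \<open>y\<close> agree, so the affine combination keeps the common value.\<close>
    have "w e \<in> marked_order_polyhedron P R A lam"
      using x y e(2) by (auto simp: marked_order_polyhedron_def tight_face_def w_def algebra_simps)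
    moreover have "w e $ p = w e $ q" if "p \<in> P" "q \<in> P" "(p, q) \<in> R" "x $ p = x $ q" for p q
      using y that by (auto simp: tight_face_def w_def)
    ultimately show ?thesis using e(1) by (auto simp: tight_face_def w_def)
  qed
  then show ?thesis
    using convex_rel_interior_iff[OF conv] xF by auto
qed

text \<open>This removes faces from the problem. A non-empty convex set has a relative interior
  point, which handles one direction; \<open>tight_face\<close> handles the other.\<close>

lemma face_partition_iff_point_partition:
  "face_partition P R A lam \<pi> \<longleftrightarrow>
    (\<exists>x\<in>marked_order_polyhedron P R A lam. \<pi> = point_partition P R x)"
proof
  assume "face_partition P R A lam \<pi>"
  then obtain F where F: "F face_of marked_order_polyhedron P R A lam" "F \<noteq> {}"
    "\<pi> = partition_of_face P R F"
    by (auto simp: face_partition_def)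
  have "rel_interior F \<noteq> {}"
    using F(1,2) face_of_imp_convex rel_interior_eq_empty by blast
  then obtain x where "x \<in> rel_interior F" by blast
  moreover from this have "x \<in> marked_order_polyhedron P R A lam"
    using F(1) rel_interior_subset face_of_imp_subset by blast
  ultimately show "\<exists>x\<in>marked_order_polyhedron P R A lam. \<pi> = point_partition P R x"
    using F point_partition_eq_partition_of_face by blast
next
  assume "\<exists>x\<in>marked_order_polyhedron P R A lam. \<pi> = point_partition P R x"
  then obtain x where "x \<in> marked_order_polyhedron P R A lam" "\<pi> = point_partition P R x"
    by blast
  then show "face_partition P R A lam \<pi>"
    using point_partition_eq_partition_of_face[OF tight_face_face_of rel_interior_tight_face]
      rel_interior_tight_face rel_interior_subset tight_face_face_of
    unfolding face_partition_def by blast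
qed

section \<open>Partitions induced by points\<close>

text \<open>Along a chain generating the quotient order, each step either stays in its block or
  strictly raises \<open>f\<close>. Such an \<open>f\<close> excludes cycles among distinct
  blocks.\<close>

lemma strict_on_quotient_order:
  fixes f :: "'a set \<Rightarrow> real"
  assumes "\<And>B C p q. B \<in> \<pi> \<Longrightarrow> C \<in> \<pi> \<Longrightarrow> p \<in> B \<Longrightarrow> q \<in> C \<Longrightarrow> (p, q) \<in> R \<Longrightarrow> B = C \<or> f B < f C"
  assumes "(B, C) \<in> quotient_order R \<pi>"
  shows "B = C \<or> f B < f C"
  using assms(2) unfolding quotient_order_def
proof (induction rule: trancl_induct)
  case (base C)
  then show ?case using assms(1) by blast
next
  case (step C D)
  then have "C = D \<or> f C < f D" using assms(1) by blast
  with step.IH show ?case by auto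
qed

definition point_relation ::
  "'a::finite set \<Rightarrow> ('a \<times> 'a) set \<Rightarrow> real^'a \<Rightarrow> ('a \<times> 'a) set" where
  "point_relation P R x = {(p, q). p \<in> P \<and> q \<in> P \<and> x $ p = x $ q \<and> comparable R p q}\<^sup>+"

lemma point_partition_quotient: "point_partition P R x = P // point_relation P R x"
  by (simp add: point_partition_def point_relation_def)

lemma point_relationI:
  assumes "p \<in> P" "q \<in> P" "x $ p = x $ q" "comparable R p q"
  shows "(p, q) \<in> point_relation P R x"
  unfolding point_relation_def by (rule r_into_trancl) (simp add: assms)

lemma comparable_refl: "partial_order_on P R \<Longrightarrow> p \<in> P \<Longrightarrow> comparable R p p"
  by (auto simp: comparable_def partial_order_on_def preorder_on_def refl_on_def)

lemma equiv_point_relation: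
  assumes "partial_order_on P R"
  shows "equiv P (point_relation P R x)"
proof (rule equivI)
  show "point_relation P R x \<subseteq> P \<times> P"
    unfolding point_relation_def by (rule trancl_subset_Sigma) auto
  then show "refl_on P (point_relation P R x)"
    by (auto simp: refl_on_def intro: point_relationI comparable_refl[OF assms])
  show "sym (point_relation P R x)"
    unfolding point_relation_def by (rule sym_trancl) (auto simp: sym_def comparable_def)
  show "trans (point_relation P R x)"
    unfolding point_relation_def by (rule trans_trancl)
qed

lemma point_relation_imp_eq:
  assumes "(p, q) \<in> point_relation P R x"
  shows "x $ p = x $ q"
  using assms unfolding point_relation_def
proof (induction rule: trancl_induct)
  case (step y z)
  then show ?case by (metis (mono_tags, lifting) case_prodD mem_Collect_eq)
qed simp

text \<open>Every element of a chain of comparable elements with equal values is related to the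
  start \<open>p\<close>, so the chain never leaves the block of \<open>p\<close> and is itself a
  path in that block.\<close>

lemma connected_point_partition:
  assumes "partial_order_on P R"
  shows "connected_partition R (point_partition P R x)"
  unfolding connected_partition_def connected_subposet_def point_partition_quotient
proof (intro ballI)
  fix B p q assume B: "B \<in> P // point_relation P R x" and pq: "p \<in> B" "q \<in> B"
  note eq = equiv_point_relation[OF assms, of x]
  have closed: "y \<in> B" if "(p, y) \<in> point_relation P R x" for y
    using in_quotient_imp_closed[OF eq B pq(1) that] .
  let ?C = "{(u, v). u \<in> B \<and> v \<in> B \<and> comparable R u v}"
  have "(p, q) \<in> point_relation P R x"
    using quotient_eq_iff[OF eq B B pq] by simp
  then show "(p, q) \<in> ?C\<^sup>*"
    unfolding point_relation_def
  proof (induction rule: trancl_induct)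
    case (base y)
    then have "y \<in> B" by (intro closed) (auto intro: point_relationI)
    then have "(p, y) \<in> ?C" using base pq(1) by simp
    then show ?case by (rule r_into_rtrancl)
  next
    case (step y z)
    have "y \<in> B"
      using step.hyps(1) by (intro closed) (simp add: point_relation_def)
    moreover have "z \<in> B"
      using trancl_into_trancl[OF step.hyps] by (intro closed) (simp add: point_relation_def)
    ultimately have "(y, z) \<in> ?C" using step.hyps(2) by simp
    with step.IH show ?case by (rule rtrancl_into_rtrancl)
  qed
qed

text \<open>The point \<open>x\<close> is constant on blocks and descends to a function
  \<open>f\<close> on them. This \<open>f\<close> is strictly increasing for the quotient order and
  agrees with the induced marking on non-free blocks.\<close>

lemma point_partition_properties:
  assumes M: "marked_poset P R A lam" and x: "x \<in> marked_order_polyhedron P R A lam"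
    and \<pi>: "\<pi> = point_partition P R x"
  shows "marked_poset_compatible R A lam \<pi>"
    and "strict_marking (quotient_order R \<pi>) (quotient_marked A \<pi>) (quotient_marking A lam)"
proof -
  have po: "partial_order_on P R" using M by (auto simp: marked_poset_def)
  note eq = equiv_point_relation[OF po, of x]
  have block: "B \<in> P // point_relation P R x" if "B \<in> \<pi>" for B
    using that by (simp add: \<pi> point_partition_quotient)
  have sub: "p \<in> P" if "B \<in> \<pi>" "p \<in> B" for B p
    using in_quotient_imp_subset[OF eq block] that by blast
  define f where "f B = x $ (SOME p. p \<in> B)" for B
  have f: "f B = x $ p" if "B \<in> \<pi>" "p \<in> B" for B p
  proof -
    have "(SOME p. p \<in> B) \<in> B" using that(2) by (rule someI)
    then have "((SOME p. p \<in> B), p) \<in> point_relation P R x"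
      using quotient_eq_iff[OF eq block block] that by blast
    then show ?thesis unfolding f_def by (rule point_relation_imp_eq)
  qed
  have gen: "B = C \<or> f B < f C"
    if BC: "B \<in> \<pi>" "C \<in> \<pi>" "p \<in> B" "q \<in> C" "(p, q) \<in> R" for B C p q
  proof -
    have pq: "p \<in> P" "q \<in> P" using sub BC by blast+
    have le: "x $ p \<le> x $ q"
      using x pq BC(5) unfolding marked_order_polyhedron_def by blast
    show ?thesis
    \<comment> \<open>A tight relation merges the two blocks; any other is a strict inequality
      between their values.\<close>
    proof (cases "x $ p = x $ q")
      case True
      then have "(p, q) \<in> point_relation P R x"
        using pq BC(5) by (intro point_relationI) (simp_all add: comparable_def)
      then show ?thesis using quotient_eq_iff[OF eq block block] BC by blast
    next
      case False
      then show ?thesis using le f[OF BC(1,3)] f[OF BC(2,4)] by simp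
    qed
  qed
  have mono: "B = C \<or> f B < f C" if "(B, C) \<in> quotient_order R \<pi>" for B C
    using strict_on_quotient_order[of \<pi> R f, OF gen that] .
  have lam: "lam a = f B" if "B \<in> \<pi>" "a \<in> B" "a \<in> A" for a B
    using x f[OF that(1,2)] that(3) by (simp add: marked_order_polyhedron_def)
  \<comment> \<open>Distinct blocks related both ways would give
    \<open>f B < f C < f B\<close>.\<close>
  have "antisym (quotient_order R \<pi>)"
    by (rule antisymI) (metis mono less_asym)
  then show "marked_poset_compatible R A lam \<pi>"
    unfolding marked_poset_compatible_def poset_compatible_def
    by (metis IntD1 IntD2 lam less_imp_le mono order_refl)
  have "quotient_marking A lam B = f B" if "B \<in> quotient_marked A \<pi>" for B
  proof -
    have "(SOME a. a \<in> B \<inter> A) \<in> B \<inter> A"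
      using that unfolding some_in_eq by (simp add: quotient_marked_def)
    then show ?thesis
      using lam[of B] that by (simp add: quotient_marking_def quotient_marked_def)
  qed
  then show "strict_marking (quotient_order R \<pi>) (quotient_marked A \<pi>) (quotient_marking A lam)"
    using mono unfolding strict_marking_def by metis
qed

section \<open>A point realizing a given partition\<close>

text \<open>The induced marking extends to a strictly monotone \<open>g\<close> on all blocks, and
  \<open>x\<close> is its pullback to \<open>P\<close>. Strictness of \<open>g\<close> keeps
  different blocks apart, and connectedness keeps each block in one piece.\<close>

lemma point_of_partition:
  assumes M: "marked_poset P R A lam" and part: "partition_on P \<pi>"
    and comp: "marked_poset_compatible R A lam \<pi>" and con: "connected_partition R \<pi>"
    and strict:
      "strict_marking (quotient_order R \<pi>) (quotient_marked A \<pi>) (quotient_marking A lam)"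
  obtains x where "x \<in> marked_order_polyhedron P R A lam" "\<pi> = point_partition P R x"
proof -
  have po: "partial_order_on P R" and fin: "finite P" and AP: "A \<subseteq> P"
    using M by (auto simp: marked_poset_def)
  have fin\<pi>: "finite \<pi>" using fin part finite_elements by blast
  have m\<pi>: "quotient_marked A \<pi> \<subseteq> \<pi>" by (auto simp: quotient_marked_def)
  have "antisym (quotient_order R \<pi>)"
    using comp by (auto simp: marked_poset_compatible_def poset_compatible_def)
  moreover have "trans (quotient_order R \<pi>)" by (simp add: quotient_order_def)
  ultimately obtain g where g: "\<forall>B\<in>quotient_marked A \<pi>. g B = quotient_marking A lam B"
    "strict_marking (quotient_order R \<pi>) (quotient_marked A \<pi> \<union> \<pi>) g"
    using strict_marking_extend[OF fin\<pi> finite_subset[OF m\<pi> fin\<pi>] _ _ strict] by blast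
  have gmono: "B = C \<or> g B < g C"
    if "B \<in> \<pi>" "C \<in> \<pi>" "p \<in> B" "q \<in> C" "(p, q) \<in> R" for B C p q
  proof -
    have "(B, C) \<in> quotient_order R \<pi>"
      unfolding quotient_order_def using that by (intro r_into_trancl) auto
    then show ?thesis using g(2) that by (auto simp: strict_marking_def)
  qed
  define blk where "blk p = (THE B. B \<in> \<pi> \<and> p \<in> B)" for p
  have blkI: "blk p = B" if "B \<in> \<pi>" "p \<in> B" for p B
  proof -
    have "C = B" if "C \<in> \<pi>" "p \<in> C" for C
      using partition_onD2[OF part] \<open>B \<in> \<pi>\<close> \<open>p \<in> B\<close> that by (metis disjointD disjoint_iff)
    then show ?thesis
      unfolding blk_def using that by (intro the_equality) blast+
  qed
  have blk: "blk p \<in> \<pi>" "p \<in> blk p" if "p \<in> P" for p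
  proof -
    obtain B where "B \<in> \<pi>" "p \<in> B" using \<open>p \<in> P\<close> partition_onD1[OF part] by blast
    then show "blk p \<in> \<pi>" "p \<in> blk p" using blkI by simp_all
  qed
  \<comment> \<open>The value 0 outside \<open>P\<close> is what membership in the coordinate
    subspace demands.\<close>
  define x :: "real^'a" where "x = (\<chi> p. if p \<in> P then g (blk p) else 0)"
  have x: "x $ p = g (blk p)" if "p \<in> P" for p using that by (simp add: x_def)
  have mono: "blk p = blk q \<or> x $ p < x $ q" if "p \<in> P" "q \<in> P" "(p, q) \<in> R" for p q
    using gmono[OF blk(1) blk(1) blk(2) blk(2)] that by (simp add: x)
  have "x $ a = lam a" if "a \<in> A" for a
  proof -
    have a: "a \<in> P" using that AP by auto
    then have "blk a \<in> quotient_marked A \<pi>"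
      using blk[OF a] that unfolding quotient_marked_def by blast
    then have "x $ a = quotient_marking A lam (blk a)" using g(1) x[OF a] by simp
    also have "\<dots> = lam a"
      using quotient_marking_eq[OF po part comp blk(1)[OF a]] blk(2)[OF a] that by simp
    finally show ?thesis .
  qed
  moreover have "x $ p \<le> x $ q" if "p \<in> P" "q \<in> P" "(p, q) \<in> R" for p q
    using mono[OF that] x that by fastforce
  moreover have "x $ p = 0" if "p \<notin> P" for p using that by (simp add: x_def)
  ultimately have xO: "x \<in> marked_order_polyhedron P R A lam"
    unfolding marked_order_polyhedron_def by blast
  \<comment> \<open>From left to right, comparable elements with equal values share a block by
    \<open>mono\<close>. From right to left, a path inside a connected block consists of tight
    relations, since \<open>x\<close> is constant on the block.\<close>
  have "point_relation P R x = {(p, q). \<exists>B\<in>\<pi>. p \<in> B \<and> q \<in> B}"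
  proof (intro subset_antisym subrelI)
    have tight: "blk p = blk q" if "p \<in> P" "q \<in> P" "x $ p = x $ q" "comparable R p q" for p q
      using mono[of p q] mono[of q p] that unfolding comparable_def by (metis less_irrefl)
    fix p q assume "(p, q) \<in> point_relation P R x"
    then have "p \<in> P \<and> q \<in> P \<and> blk p = blk q"
      unfolding point_relation_def
    proof (induction rule: trancl_induct)
      case (base q)
      then show ?case using tight[of p q] by simp
    next
      case (step q r)
      then show ?case using tight[of q r] by simp
    qed
    then show "(p, q) \<in> {(p, q). \<exists>B\<in>\<pi>. p \<in> B \<and> q \<in> B}"
      using blk[of p] blk[of q] by auto
  next
    fix p q assume "(p, q) \<in> {(p, q). \<exists>B\<in>\<pi>. p \<in> B \<and> q \<in> B}"
    then obtain B where B: "B \<in> \<pi>" "p \<in> B" "q \<in> B" by blast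
    have BP: "u \<in> P" if "u \<in> B" for u using B(1) partition_onD1[OF part] that by blast
    let ?C = "{(u, v). u \<in> B \<and> v \<in> B \<and> comparable R u v}"
    have "(p, q) \<in> ?C\<^sup>*"
      using con B unfolding connected_partition_def connected_subposet_def by blast
    then show "(p, q) \<in> point_relation P R x"
    proof (induction rule: rtrancl_induct)
      case base
      \<comment> \<open>A path of length zero still needs one step in the transitive closure;
        reflexivity of \<open>R\<close> supplies it.\<close>
      then show ?case using BP[OF B(2)] comparable_refl[OF po] by (intro point_relationI) auto
    next
      case (step u v)
      then have "(u, v) \<in> point_relation P R x"
        using BP x blkI[OF B(1)] by (intro point_relationI) auto
      with step.IH show ?case
        unfolding point_relation_def by (rule trancl_trans)
    qed
  qed
  then have "\<pi> = point_partition P R x"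
    using partition_on_eq_quotient[OF part] by (simp add: point_partition_quotient)
  with xO show ?thesis by (rule that)
qed

theorem theorem3p14:
  fixes P :: "'a::finite set" and R :: "('a \<times> 'a) set"
    and A :: "'a set" and lam :: "'a \<Rightarrow> real" and \<pi> :: "'a set set"
  assumes "marked_poset P R A lam"
    and "partition_on P \<pi>"
  shows "face_partition P R A lam \<pi> \<longleftrightarrow>
    marked_poset_compatible R A lam \<pi> \<and>
    connected_partition R \<pi> \<and>
    strict_marking (quotient_order R \<pi>) (quotient_marked A \<pi>) (quotient_marking A lam)"
proof
  assume "face_partition P R A lam \<pi>"
  then obtain x where "x \<in> marked_order_polyhedron P R A lam" "\<pi> = point_partition P R x"
    by (auto simp: face_partition_iff_point_partition)
  moreover have "partial_order_on P R" using assms(1) by (simp add: marked_poset_def)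
  ultimately show "marked_poset_compatible R A lam \<pi> \<and> connected_partition R \<pi> \<and>
    strict_marking (quotient_order R \<pi>) (quotient_marked A \<pi>) (quotient_marking A lam)"
    using point_partition_properties[OF assms(1)] connected_point_partition by blast
next
  assume "marked_poset_compatible R A lam \<pi> \<and> connected_partition R \<pi> \<and>
    strict_marking (quotient_order R \<pi>) (quotient_marked A \<pi>) (quotient_marking A lam)"
  then show "face_partition P R A lam \<pi>"
    using point_of_partition[OF assms] face_partition_iff_point_partition by metis
qed

end
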